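(* Let $n\in\mathbb{N}$ and let $S\subset\mathbb{R}^n$ be a nondegenerate $n$-dimensional simplex inscribed in the unit ball $B_n$ (i.e., all vertices $x_1,\ldots,x_{n+1}$ of $S$ satisfy $\|x_i\|=1$). If some vertex of $S$ (regarded as a $0$-dimensional face) is suitable, then for each $m\in\{1,\ldots,n-1\}$ the simplex $S$ has a suitable $m$-dimensional face containing this vertex.
   Context: $\|x\|=\sqrt{\langle x,x\rangle}$ is the standard Euclidean norm on $\mathbb{R}^n$, and $B_n=\{x\in\mathbb{R}^n:\|x\|\le 1\}$. For a nondegenerate $n$-dimensional simplex $S$ with vertices $x_1,\ldots,x_{n+1}$, let $E$ be the (unique) ellipsoid of minimum volume containing $S$. For a set $J\subset\{1,\ldots,n+1\}$ with $|J|=k$, $1\le k\le n$, let $g_J=\frac1k\sum_{j\in J}x_j$ be the center of gravity of the $(k-1)$-dimensional face of $S$ with vertices $x_j$, $j\in J$, and let $h_J=\frac{1}{n+1-k}\sum_{j\notin J}x_j$ be the center of gravity of the opposite $(n-k)$-dimensional face, whose vertices are the remaining $n+1-k$ vertices. The point $y_J$ is the intersection point with the boundary of $E$ of the line passing through $g_J$ and $h_J$ in the direction from $g_J$ to $h_J$; that is, $y_J=g_J+t(h_J-g_J)$, where $t$ is the largest real number for which this point lies on the boundary of $E$. The $(k-1)$-dimensional face of $S$ with vertices $x_j$, $j\in J$, is called suitable if $y_J\in B_n$. In particular, a vertex $x_i$ is suitable if $y_{\{i\}}\in B_n$. *)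

theory Defs
  imports "HOL-Analysis.Analysis"
begin

text \<open>
  A simplex in \<open>real ^ 'n\<close> (so \<open>n = CARD('n)\<close>) is given by its labelled vertices
  \<open>x 1, \<dots>, x (n + 1)\<close>; the values of \<open>x\<close> at other indices are irrelevant.
  Faces are given by the index sets \<open>J\<close> of their vertices.
\<close>

definition vertex_indices :: "(nat \<Rightarrow> real ^ 'n) \<Rightarrow> nat set" where
  "vertex_indices (x :: nat \<Rightarrow> real ^ 'n) = {1..CARD('n) + 1}"

text \<open>Injectivity is needed because \<^const>\<open>affine_dependent\<close> is a property of the set of vertices.\<close>

definition nondegenerate_simplex :: "(nat \<Rightarrow> real ^ 'n) \<Rightarrow> bool" where
  "nondegenerate_simplex x \<longleftrightarrow>
     inj_on x (vertex_indices x) \<and> \<not> affine_dependent (x ` vertex_indices x)"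

definition simplex_hull :: "(nat \<Rightarrow> real ^ 'n) \<Rightarrow> (real ^ 'n) set" where
  "simplex_hull x = convex hull (x ` vertex_indices x)"

text \<open>Ellipsoids are solid, nondegenerate, and may have any center.\<close>

definition ellipsoid :: "(real ^ 'n) set \<Rightarrow> bool" where
  "ellipsoid E \<longleftrightarrow>
     (\<exists>(A :: real ^ 'n ^ 'n) c. invertible A \<and> E = (\<lambda>v. c + A *v v) ` cball 0 1)"

definition is_min_ellipsoid :: "(real ^ 'n) set \<Rightarrow> (real ^ 'n) set \<Rightarrow> bool" where
  "is_min_ellipsoid S E \<longleftrightarrow>
     ellipsoid E \<and> S \<subseteq> E \<and>
     (\<forall>E'. ellipsoid E' \<and> S \<subseteq> E' \<longrightarrow> measure lebesgue E \<le> measure lebesgue E')"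

definition min_ellipsoid :: "(real ^ 'n) set \<Rightarrow> (real ^ 'n) set" where
  "min_ellipsoid S = (THE E. is_min_ellipsoid S E)"

definition gravity_center :: "(nat \<Rightarrow> real ^ 'n) \<Rightarrow> nat set \<Rightarrow> real ^ 'n" where
  "gravity_center x J = (1 / real (card J)) *\<^sub>R (\<Sum>j\<in>J. x j)"

definition exit_point :: "(nat \<Rightarrow> real ^ 'n) \<Rightarrow> nat set \<Rightarrow> real ^ 'n" where
  "exit_point x J =
     (let g = gravity_center x J;
          h = gravity_center x (vertex_indices x - J);
          t = (GREATEST t :: real. g + t *\<^sub>R (h - g) \<in> frontier (min_ellipsoid (simplex_hull x)))
      in g + t *\<^sub>R (h - g))"

text \<open>Meaningful for nonempty proper subsets \<open>J\<close> of \<^term>\<open>vertex_indices x\<close>.\<close>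

definition suitable :: "(nat \<Rightarrow> real ^ 'n) \<Rightarrow> nat set \<Rightarrow> bool" where
  "suitable x J \<longleftrightarrow> exit_point x J \<in> cball 0 1"

end

theory Submission
  imports Defs
begin

text \<open>
  Let \<open>c\<close> be the center of gravity of the simplex. An affine map \<open>v \<mapsto> c + T v\<close> sends a regular simplex
  inscribed in the unit sphere to the given one. An averaging argument over the vertices together
  with the inequality between determinant and Frobenius norm (\<open>det_le_1_of_norm_le\<close>) shows that the
  unit ball is the unique ellipsoid of minimal volume around the regular simplex; hence the minimal
  ellipsoid of the given simplex is the image of the unit ball (\<open>min_ellipsoid_simplex\<close>). In these
  coordinates every line from \<open>g\<^sub>J\<close> to \<open>h\<^sub>J\<close> passes through the center, and one reads off that, for a
  face with \<open>k\<close> vertices, \<open>y\<^sub>J = c - s (g\<^sub>J - c)\<close> with \<open>s = sqrt (n k / (n + 1 - k))\<close>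
  (\<open>exit_point_eq\<close>).

  In particular \<open>y\<^sub>i = 2 c - x\<^sub>i\<close>, so the vertex \<open>x\<^sub>i\<close> is suitable iff \<open>c \<bullet> c \<le> c \<bullet> x\<^sub>i\<close>. On the other hand,
  since all vertices are unit vectors, the mean of the squared norm of \<open>y\<^sub>J\<close> over all \<open>J\<close> with \<open>k\<close>
  elements and \<open>i \<in> J\<close> depends only on \<open>c \<bullet> c\<close> and \<open>c \<bullet> x\<^sub>i\<close>: it equals \<open>1 - \<beta> (c \<bullet> x\<^sub>i - c \<bullet> c)\<close>
  with an explicit constant \<open>\<beta> \<ge> 0\<close> (\<open>average_identity\<close>, \<open>average_coefficient_nonneg\<close>). Hence the
  mean is at most 1, and some \<open>J\<close> does not exceed the mean (\<open>exists_subset_le_average\<close>).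
\<close>

section \<open>Linear images and Lebesgue measure\<close>

lemma det_shear:
  fixes m n :: "'n::finite"
  assumes "m \<noteq> n"
  shows "det (\<chi> i j. of_bool (i = m \<and> j = n \<or> i = j) :: real ^ 'n ^ 'n) = 1"
proof -
  have "(\<chi> i j. of_bool (i = m \<and> j = n \<or> i = j) :: real ^ 'n ^ 'n)
      = (\<chi> k. if k = m then row m (mat 1) + 1 *s row n (mat 1) else row k (mat 1))"
    using assms by (auto simp: vec_eq_iff row_def mat_def)
  then show ?thesis
    by (simp add: det_row_operation[OF assms])
qed

text \<open>
  After translating the box so that its lower corner is the origin, its \<open>n\<close>-th coordinates are
  nonnegative and \<open>measure_shear_interval\<close> applies.
\<close>

lemma measure_shear_box:
  fixes a b :: "real ^ 'n" and m n :: 'n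
  assumes "m \<noteq> n"
  defines "E \<equiv> \<chi> i j. of_bool (i = m \<and> j = n \<or> i = j) :: real ^ 'n ^ 'n"
  shows "measure lebesgue ((*v) E ` cbox a b) = measure lebesgue (cbox a b)"
proof (cases "cbox a b = {}")
  case False
  have E: "(*v) E = (\<lambda>v. \<chi> i. if i = m then v $ m + v $ n else v $ i)"
  proof
    fix v :: "real ^ 'n"
    have "(\<Sum>j\<in>UNIV. of_bool (j = n \<or> m = j) * v $ j) = (\<Sum>j\<in>{m,n}. v $ j)"
      by (rule sum.mono_neutral_cong_right) auto
    moreover have "(\<Sum>j\<in>UNIV. of_bool (i = j) * v $ j) = v $ i" for i
      by (subst sum.remove[of _ i]) auto
    ultimately show "E *v v = (\<chi> i. if i = m then v $ m + v $ n else v $ i)"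
      using assms(1) by (simp add: vec_eq_iff E_def matrix_vector_mult_def)
  qed
  have box: "cbox a b = (+) a ` cbox 0 (b - a)"
    using cbox_translation[of a 0 "b - a"] by simp
  then have ne: "cbox 0 (b - a) \<noteq> {}"
    using False by auto
  have "(*v) E ` cbox a b = (+) (E *v a) ` (*v) E ` cbox 0 (b - a)"
    unfolding box image_image by (simp add: matrix_vector_right_distrib)
  then have "measure lebesgue ((*v) E ` cbox a b) = measure lebesgue ((*v) E ` cbox 0 (b - a))"
    by (simp add: measure_translation)
  also have "\<dots> = measure lebesgue (cbox 0 (b - a))"
    unfolding E by (rule measure_shear_interval) (use assms ne in auto)
  also have "\<dots> = measure lebesgue (cbox a b)"
    unfolding box by (simp only: measure_translation)
  finally show ?thesis .
qed auto

text \<open>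
  \<open>measure_linear_image\<close> says the same for a linearly ordered index type. The order serves only to make
  the matrix of an elementary shear triangular; evaluating its determinant by a row operation
  instead gives the result for every finite index type. As in that case, it suffices to treat zero
  rows, diagonal matrices, transpositions and shears, and to test the last two on boxes.
\<close>

lemma measure_matrix_image:
  fixes A :: "real ^ 'n ^ 'n"
  assumes "S \<in> lmeasurable"
  shows "measure lebesgue ((*v) A ` S) = \<bar>det A\<bar> * measure lebesgue S"
proof -
  define P where "P A \<longleftrightarrow> (\<forall>S\<in>lmeasurable. (*v) A ` S \<in> lmeasurable \<and>
      measure lebesgue ((*v) A ` S) = \<bar>det A\<bar> * measure lebesgue S)" for A :: "real ^ 'n ^ 'n"
  have boxI: "P A" if "\<And>a b. measure lebesgue ((*v) A ` cbox a b) = \<bar>det A\<bar> * measure lebesgue (cbox a b)"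
    for A
    using measure_linear_sufficient[of "(*v) A" _ "\<bar>det A\<bar>"] that by (auto simp: P_def)
  have "P A"
  proof (rule induct_matrix_elementary_alt)
    fix A B assume "P A" "P B"
    then show "P (A ** B)"
      unfolding P_def matrix_vector_mult_matrix_matrix_mult_compose image_comp[symmetric]
      by (simp add: det_mul abs_mult)
  next
    fix A :: "real ^ 'n ^ 'n" and i assume r: "row i A = 0"
    have d: "det A = 0"
      using det_zero_row(2)[OF r] .
    then have "\<not> inj ((*v) A)"
      by (metis det_nz_iff_inj matrix_of_matrix_vector_mul matrix_vector_mul_linear)
    then have "negligible ((*v) A ` S)" for S
      by (intro negligible_linear_singular_image) auto
    then show "P A"
      by (intro boxI) (simp add: d negligible_imp_measure0)
  next
    fix A :: "real ^ 'n ^ 'n" assume diag: "\<And>i j. i \<noteq> j \<Longrightarrow> A $ i $ j = 0"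
    have "(\<Sum>j\<in>UNIV. A $ i $ j * x $ j) = A $ i $ i * x $ i" for i and x :: "real ^ 'n"
      by (subst sum.remove[of _ i]) (auto simp: diag intro!: sum.neutral)
    then have "(*v) A = (\<lambda>x. \<chi> i. A $ i $ i * x $ i)"
      by (auto simp: vec_eq_iff matrix_vector_mult_def fun_eq_iff)
    then show "P A"
      using measure_stretch[of _ "\<lambda>i. A $ i $ i"] 
      by (intro boxI) (simp add: det_diagonal[OF diag])
  next
    fix m n :: 'n assume "m \<noteq> n"
    let ?t = "Transposition.transpose m n"
    let ?A = "\<chi> i j. mat 1 $ i $ ?t j :: real ^ 'n ^ 'n"
    have d: "\<bar>det ?A\<bar> = 1"
      using \<open>m \<noteq> n\<close> by (simp add: det_permute_columns permutes_swap_id sign_swap_id abs_mult)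
    have A: "?A *v x = (\<chi> i. x $ ?t i)" for x
    proof -
      have "i = ?t j \<longleftrightarrow> ?t i = j" for i j
        by (metis transpose_involutory)
      moreover have "(\<Sum>j\<in>UNIV. of_bool (?t i = j) * x $ j) = x $ ?t i" for i
        by (subst sum.remove[of _ "?t i"]) auto
      ultimately show ?thesis
        by (simp add: vec_eq_iff matrix_vector_mult_def mat_def of_bool_def)
    qed
    have "(*v) ?A ` cbox a b = cbox (\<chi> i. a $ ?t i) (\<chi> i. b $ ?t i)" for a b
    proof (intro equalityI subsetI)
      fix y assume "y \<in> cbox (\<chi> i. a $ ?t i) (\<chi> i. b $ ?t i)"
      then have "(\<chi> i. y $ ?t i) \<in> cbox a b"
        by (auto simp: mem_box_cart) (metis transpose_involutory)+
      moreover have "y = ?A *v (\<chi> i. y $ ?t i)"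
        by (simp add: A vec_eq_iff)
      ultimately show "y \<in> (*v) ?A ` cbox a b" by blast
    qed (auto simp: A mem_box_cart)
    moreover have "measure lebesgue (cbox (\<chi> i. a $ ?t i) (\<chi> i. b $ ?t i)) = measure lebesgue (cbox a b)"
      for a b :: "real ^ 'n"
    proof -
      have "(\<forall>i. a $ ?t i \<le> b $ ?t i) \<longleftrightarrow> (\<forall>i. a $ i \<le> b $ i)"
        by (metis transpose_involutory)
      moreover have "(\<Prod>i\<in>UNIV. b $ ?t i - a $ ?t i) = (\<Prod>i\<in>UNIV. b $ i - a $ i)"
        using prod.permute[OF permutes_swap_id, of m UNIV n "\<lambda>i. b $ i - a $ i"] by (simp add: o_def)
      ultimately show ?thesis
        by (simp add: content_cbox_if_cart interval_eq_empty_cart not_less[symmetric])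
    qed
    ultimately show "P ?A"
      by (intro boxI) (simp add: d)
  next
    fix m n :: 'n assume "m \<noteq> n"
    then show "P (\<chi> i j. of_bool (i = m \<and> j = n \<or> i = j))"
      by (intro boxI) (simp only: det_shear[OF \<open>m \<noteq> n\<close>] measure_shear_box[OF \<open>m \<noteq> n\<close>] abs_one mult_1)
  qed
  with assms show ?thesis
    by (simp add: P_def)
qed

section \<open>Determinants on a Frobenius ball\<close>

text \<open>The norm on \<^typ>\<open>real ^ 'n ^ 'm\<close> is the Frobenius norm.\<close>

lemma norm_matrix_eq: "(norm (M :: real ^ 'n ^ 'm))\<^sup>2 = (\<Sum>i\<in>UNIV. (norm (M $ i))\<^sup>2)"
  by (simp add: norm_vec_def L2_set_def sum_nonneg)

lemma det_scaleR:
  fixes M :: "real ^ 'n ^ 'n"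
  shows "det (c *\<^sub>R M) = c ^ CARD('n) * det M"
  using det_rows_mul[of "\<lambda>_. c" "\<lambda>i. M $ i"]
  by (simp add: scalar_mult_eq_scaleR scaleR_vec_def[abs_def])

text \<open>
  A matrix whose determinant has the maximal modulus over the Frobenius ball of radius \<open>R\<close> has at
  least norm \<open>R\<close>, for otherwise scaling it up would increase the determinant.
\<close>

lemma norm_ge_of_maximal_det:
  fixes M N :: "real ^ 'n ^ 'n"
  assumes max: "\<And>N :: real ^ 'n ^ 'n. norm N \<le> R \<Longrightarrow> \<bar>det N\<bar> \<le> \<bar>det M\<bar>"
    and "R > 0" "det M \<noteq> 0" and N: "\<bar>det N\<bar> = \<bar>det M\<bar>"
  shows "R \<le> norm N"
proof (rule ccontr)
  assume "\<not> R \<le> norm N"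
  moreover have "N \<noteq> 0"
    using assms(3,4) det_scaleR[of 0 M] by (auto simp: power_0_left)
  ultimately have N0: "norm N > 0" "R / norm N > 1"
    by (auto simp: field_simps)
  have "\<bar>det ((R / norm N) *\<^sub>R N)\<bar> \<le> \<bar>det M\<bar>"
    using \<open>R > 0\<close> N0 by (intro max) simp
  then have "(R / norm N) ^ CARD('n) \<le> 1"
    using N0 assms by (simp add: det_scaleR abs_mult)
  moreover have "(R / norm N) ^ CARD('n) > 1"
    using N0 by (intro one_less_power) auto
  ultimately show False by simp
qed

text \<open>
  Subtracting from one row its projection onto another, and scaling two rows by reciprocal factors,
  preserve the determinant. If neither operation can decrease the Frobenius norm, the rows are
  orthogonal and have equal length; the prescribed norm of the matrix makes this length 1.
\<close>

lemma orthogonal_of_minimal_norm: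
  fixes M :: "real ^ 'n ^ 'n"
  assumes min: "\<And>N :: real ^ 'n ^ 'n. \<bar>det N\<bar> = \<bar>det M\<bar> \<Longrightarrow> norm M \<le> norm N"
    and "det M \<noteq> 0" and nM: "(norm M)\<^sup>2 = real CARD('n)"
  shows "orthogonal_matrix M"
proof -
  have nz: "M $ i \<noteq> 0" for i
    using \<open>det M \<noteq> 0\<close> det_zero_row(2)[of i M] by (auto simp: row_def)
  have orth: "M $ i \<bullet> M $ j = 0" if "i \<noteq> j" for i j
  proof -
    \<comment> \<open>With this \<open>c\<close>, \<open>M $ i + c *\<^sub>R M $ j\<close> is the component of \<open>M $ i\<close> orthogonal to \<open>M $ j\<close>.\<close>
    define c where "c = - (M $ i \<bullet> M $ j) / (M $ j \<bullet> M $ j)"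
    define N where "N = (\<chi> k. if k = i then row i M + c *s row j M else row k M)"
    have "det N = det M"
      unfolding N_def by (rule det_row_operation[OF that])
    then have "(norm M)\<^sup>2 \<le> (norm N)\<^sup>2"
      using min[of N] by simp
    moreover have Nk: "N $ k = (if k = i then M $ i + c *\<^sub>R M $ j else M $ k)" for k
      by (simp add: N_def row_def scalar_mult_eq_scaleR)
    ultimately have "(norm (M $ i))\<^sup>2 \<le> (norm (M $ i + c *\<^sub>R M $ j))\<^sup>2"
      unfolding norm_matrix_eq by (simp add: sum.remove[of UNIV i])
    also have "\<dots> = (norm (M $ i))\<^sup>2 - (M $ i \<bullet> M $ j)\<^sup>2 / (M $ j \<bullet> M $ j)"
    proof -
      have "(norm (M $ i + c *\<^sub>R M $ j))\<^sup>2
          = (norm (M $ i))\<^sup>2 + 2 * c * (M $ i \<bullet> M $ j) + c\<^sup>2 * (M $ j \<bullet> M $ j)"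
        unfolding power2_norm_eq_inner
        by (simp add: inner_add_left inner_add_right inner_commute power2_eq_square)
      then show ?thesis
        using nz[of j] by (simp add: c_def field_simps power2_eq_square)
    qed
    finally have "(M $ i \<bullet> M $ j)\<^sup>2 / (M $ j \<bullet> M $ j) \<le> 0"
      by simp
    then show ?thesis
      using nz[of j] by (smt (verit) divide_pos_pos inner_gt_zero_iff zero_less_power2)
  qed
  have eq: "norm (M $ i) = norm (M $ j)" for i j
  proof (cases "i = j")
    case False
    define a b where "a = norm (M $ i)" and "b = norm (M $ j)"
    have ab: "a > 0" "b > 0"
      using nz by (auto simp: a_def b_def)
    \<comment> \<open>Scaling by \<open>t\<close> and \<open>1 / t\<close> gives both rows the length \<open>sqrt (a * b)\<close>.\<close>
    define t where "t = sqrt (b / a)"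
    have t: "t > 0" "t\<^sup>2 = b / a"
      using ab by (auto simp: t_def)
    define c where "c k = (if k = i then t else if k = j then 1 / t else 1)" for k
    define N where "N = (\<chi> k. c k *s M $ k)"
    have "prod c UNIV = 1"
      using t False by (simp add: prod.remove[of UNIV i] prod.remove[of "UNIV - {i}" j] c_def)
    then have "det N = det M"
      unfolding N_def by (simp add: det_rows_mul)
    then have "(norm M)\<^sup>2 \<le> (norm N)\<^sup>2"
      using min[of N] by simp
    moreover have Nk: "N $ k = c k *\<^sub>R M $ k" for k
      by (simp add: N_def scalar_mult_eq_scaleR)
    ultimately have "a\<^sup>2 + b\<^sup>2 \<le> t\<^sup>2 * a\<^sup>2 + (1 / t)\<^sup>2 * b\<^sup>2"
      unfolding norm_matrix_eq using False t
      by (simp add: sum.remove[of UNIV i] sum.remove[of "UNIV - {i}" j] a_def b_def c_def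
          power_mult_distrib power_divide)
    also have "\<dots> = 2 * (a * b)"
      using ab t by (simp add: power_divide power2_eq_square)
    finally have "(a - b)\<^sup>2 \<le> 0"
      by (simp add: power2_diff)
    then show ?thesis
      by (simp add: a_def b_def)
  qed simp
  have "norm (M $ i) = 1" for i
  proof -
    have "real CARD('n) = (\<Sum>k\<in>(UNIV::'n set). (norm (M $ i))\<^sup>2)"
      unfolding nM[symmetric] norm_matrix_eq by (intro sum.cong refl) (metis eq)
    then have "(norm (M $ i))\<^sup>2 = 1"
      by simp
    then show ?thesis
      by (simp add: power2_eq_1_iff) (smt (verit) norm_ge_zero)
  qed
  then show ?thesis
    using orth by (simp add: orthogonal_matrix_orthonormal_rows row_def orthogonal_def)
qed

text \<open>
  This is the arithmetic-geometric mean inequality for the singular values of \<open>M\<close>, with its equality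
  case. The proof avoids the spectral theorem: by compactness there is a maximizer of the modulus of
  the determinant, and every maximizer is orthogonal by the two preceding lemmas.
\<close>

lemma det_le_1_of_norm_le:
  fixes M :: "real ^ 'n ^ 'n"
  assumes M: "(norm M)\<^sup>2 \<le> real CARD('n)"
  shows "\<bar>det M\<bar> \<le> 1" and "\<bar>det M\<bar> = 1 \<Longrightarrow> orthogonal_matrix M \<and> (norm M)\<^sup>2 = real CARD('n)"
proof -
  let ?R = "sqrt (real CARD('n))"
  have R: "norm N \<le> ?R \<longleftrightarrow> (norm N)\<^sup>2 \<le> real CARD('n)" for N :: "real ^ 'n ^ 'n"
    by (metis norm_ge_zero real_le_rsqrt real_sqrt_le_iff real_sqrt_unique)
  have extremal: "orthogonal_matrix N \<and> (norm N)\<^sup>2 = real CARD('n)"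
    if N: "norm N \<le> ?R" and max: "\<And>N' :: real ^ 'n ^ 'n. norm N' \<le> ?R \<Longrightarrow> \<bar>det N'\<bar> \<le> \<bar>det N\<bar>" and "det N \<noteq> 0"
    for N :: "real ^ 'n ^ 'n"
  proof -
    have "?R \<le> norm N'" if "\<bar>det N'\<bar> = \<bar>det N\<bar>" for N' :: "real ^ 'n ^ 'n"
      by (rule norm_ge_of_maximal_det[OF max]) (use that \<open>det N \<noteq> 0\<close> in auto)
    then have "norm N = ?R" "\<bar>det N'\<bar> = \<bar>det N\<bar> \<Longrightarrow> norm N \<le> norm N'" for N' :: "real ^ 'n ^ 'n"
      using N order_trans[of "norm N" ?R "norm N'"] by (auto intro: antisym)
    then show ?thesis
      using orthogonal_of_minimal_norm[of N] \<open>det N \<noteq> 0\<close> by simp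
  qed
  have "continuous_on (cball 0 ?R) (\<lambda>N :: real ^ 'n ^ 'n. \<bar>det N\<bar>)"
    unfolding det_def by (intro continuous_intros)
  then obtain N :: "real ^ 'n ^ 'n" where N: "norm N \<le> ?R"
    and max: "\<And>N' :: real ^ 'n ^ 'n. norm N' \<le> ?R \<Longrightarrow> \<bar>det N'\<bar> \<le> \<bar>det N\<bar>"
    using continuous_attains_sup[of "cball 0 ?R" "\<lambda>N :: real ^ 'n ^ 'n. \<bar>det N\<bar>"] by fastforce
  have "norm (mat 1 :: real ^ 'n ^ 'n) \<le> ?R"
    unfolding R norm_matrix_eq by (simp add: mat_def power2_norm_eq_inner inner_vec_def if_distrib cong: if_cong)
  from max[OF this] have "det N \<noteq> 0"
    by auto
  then have "\<bar>det N\<bar> = 1"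
    using extremal[OF N max] det_orthogonal_matrix[of N] by auto
  then show "\<bar>det M\<bar> \<le> 1"
    using max[of M] M R by simp
  show "orthogonal_matrix M \<and> (norm M)\<^sup>2 = real CARD('n)" if "\<bar>det M\<bar> = 1"
    using that M \<open>\<bar>det N\<bar> = 1\<close> max by (intro extremal) (auto simp: R)
qed

section \<open>Regular simplices\<close>

text \<open>
  Regular simplices inscribed in the unit sphere and centered at the origin, with the vertices
  indexed as in \<^const>\<open>vertex_indices\<close>. The third condition (the vertices form a tight frame) follows
  from the other two; it is included because it is easily checked for an explicit example.
\<close>

definition regular_simplex :: "(nat \<Rightarrow> real ^ 'n) \<Rightarrow> bool" where
  "regular_simplex u \<longleftrightarrow>
     (\<forall>j\<in>vertex_indices u. norm (u j) = 1) \<and>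
     (\<forall>i\<in>vertex_indices u. \<forall>j\<in>vertex_indices u. i \<noteq> j \<longrightarrow> u i \<bullet> u j = - 1 / real CARD('n)) \<and>
     (\<forall>r. (\<Sum>j\<in>vertex_indices u. (r \<bullet> u j)\<^sup>2) = (real CARD('n) + 1) / real CARD('n) * (norm r)\<^sup>2)"

lemma regular_simplexD:
  fixes u :: "nat \<Rightarrow> real ^ 'n"
  assumes "regular_simplex u"
  shows "i \<in> vertex_indices u \<Longrightarrow> norm (u i) = 1"
    and "\<lbrakk>i \<in> vertex_indices u; j \<in> vertex_indices u; i \<noteq> j\<rbrakk> \<Longrightarrow> u i \<bullet> u j = - 1 / real CARD('n)"
    and "(\<Sum>j\<in>vertex_indices u. (r \<bullet> u j)\<^sup>2) = (real CARD('n) + 1) / real CARD('n) * (norm r)\<^sup>2"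
  using assms unfolding regular_simplex_def by simp_all

lemma finite_vertex_indices [simp]: "finite (vertex_indices x)"
  and card_vertex_indices [simp]: "card (vertex_indices (x :: nat \<Rightarrow> real ^ 'n)) = CARD('n) + 1"
  and vertex_indices_cong: "vertex_indices (x :: nat \<Rightarrow> real ^ 'n) = vertex_indices (y :: nat \<Rightarrow> real ^ 'n)"
  by (simp_all add: vertex_indices_def)

text \<open>
  The first \<open>n\<close> vertices are \<open>a e\<^sub>i + b (1, \<dots>, 1)\<close> and the last one is \<open>d (1, \<dots>, 1)\<close>, for suitable
  scalars \<open>a\<close>, \<open>b\<close>, \<open>d\<close>.
\<close>

lemma ex_regular_simplex: "\<exists>u :: nat \<Rightarrow> real ^ 'n. regular_simplex u"
proof -
  let ?n = "real CARD('n)"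
  define d a b where "d = 1 / sqrt ?n" and "a = sqrt ((?n + 1) / ?n)" and "b = - (a + d) / ?n"
  have n: "?n > 0" by simp
  have d2: "d\<^sup>2 = 1 / ?n" and a2: "a\<^sup>2 = 1 + 1 / ?n"
    using n by (simp_all add: d_def a_def power_divide add_divide_distrib)
  have nb: "?n * b = - (a + d)"
    using n by (simp add: b_def)
  have ab: "2 * a * b + ?n * b\<^sup>2 = - 1 / ?n"
  proof -
    have "2 * a * b + ?n * b\<^sup>2 = b * (2 * a + ?n * b)"
      by (simp add: algebra_simps power2_eq_square)
    also have "\<dots> = - (a + d) * (a - d) / ?n"
      unfolding nb by (simp add: b_def)
    also have "\<dots> = (d\<^sup>2 - a\<^sup>2) / ?n"
      by (simp add: algebra_simps power2_eq_square)
    finally show ?thesis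
      by (simp add: d2 a2)
  qed
  have adb: "d * (a + ?n * b) = - 1 / ?n"
    unfolding nb using d2 by (simp add: power2_eq_square)
  obtain \<sigma> where \<sigma>: "bij_betw \<sigma> {1..CARD('n)} (UNIV :: 'n set)"
    using ex_bij_betw_nat_finite_1[of "UNIV :: 'n set"] by auto
  let ?o = "1 :: real ^ 'n"
  define u where "u j = (if j = CARD('n) + 1 then d *\<^sub>R ?o else a *\<^sub>R axis (\<sigma> j) 1 + b *\<^sub>R ?o)" for j
  have o: "r \<bullet> ?o = (\<Sum>i\<in>UNIV. r $ i)" for r
    by (simp add: inner_vec_def)
  have oo: "?o \<bullet> ?o = ?n"
    by (simp add: inner_vec_def)
  have ax: "axis i 1 \<bullet> ?o = 1" "?o \<bullet> axis i 1 = 1" for i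
    by (simp_all add: inner_axis inner_axis')
  have sig: "\<sigma> i = \<sigma> j \<longleftrightarrow> i = j" if "i \<in> {1..CARD('n)}" "j \<in> {1..CARD('n)}" for i j
    by (rule inj_on_eq_iff[OF bij_betw_imp_inj_on[OF \<sigma>] that])
  have gram: "u i \<bullet> u j = (if i = j then 1 else - 1 / ?n)"
    if "i \<in> vertex_indices u" "j \<in> vertex_indices u" for i j
  proof -
    have 1: "u i \<bullet> u j = (if i = j then a\<^sup>2 else 0) + (2 * a * b + ?n * b\<^sup>2)"
      if "i \<in> {1..CARD('n)}" "j \<in> {1..CARD('n)}" for i j
      using that sig[OF that]
      by (auto simp: u_def inner_add_left inner_add_right ax oo inner_axis_axis power2_eq_square algebra_simps)
    have 2: "u i \<bullet> u (CARD('n) + 1) = d * (a + ?n * b)" "u (CARD('n) + 1) \<bullet> u i = d * (a + ?n * b)"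
      if "i \<in> {1..CARD('n)}" for i
      using that by (auto simp: u_def inner_add_left inner_add_right ax oo algebra_simps)
    have 3: "u (CARD('n) + 1) \<bullet> u (CARD('n) + 1) = 1"
    proof -
      have "d * (d * ?n) = 1"
        using d2 by (simp add: power2_eq_square flip: mult.assoc)
      then show ?thesis
        by (simp add: u_def oo)
    qed
    have "i \<in> {1..CARD('n)} \<or> i = CARD('n) + 1" "j \<in> {1..CARD('n)} \<or> j = CARD('n) + 1"
      using that by (auto simp: vertex_indices_def)
    then show ?thesis
      using 1[of i j] 2[of i] 2[of j] 3 by (auto simp: ab adb a2 simp del: One_nat_def)
  qed
  have "(\<Sum>j\<in>vertex_indices u. (r \<bullet> u j)\<^sup>2) = (?n + 1) / ?n * (norm r)\<^sup>2" for r
  proof -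
    define s where "s = r \<bullet> ?o"
    have "(\<Sum>j\<in>vertex_indices u. (r \<bullet> u j)\<^sup>2) = (\<Sum>j\<in>{1..CARD('n)}. (r \<bullet> u j)\<^sup>2) + (d * s)\<^sup>2"
      by (simp add: vertex_indices_def u_def s_def)
    also have "(\<Sum>j\<in>{1..CARD('n)}. (r \<bullet> u j)\<^sup>2) = (\<Sum>j\<in>{1..CARD('n)}. (a * r $ \<sigma> j + b * s)\<^sup>2)"
      by (rule sum.cong) (auto simp: u_def inner_add_right inner_axis s_def)
    also have "\<dots> = (\<Sum>k\<in>UNIV. (a * r $ k + b * s)\<^sup>2)"
      by (rule sum.reindex_bij_betw[OF \<sigma>, of "\<lambda>k. (a * r $ k + b * s)\<^sup>2"])
    also have "\<dots> = a\<^sup>2 * (\<Sum>k\<in>UNIV. (r $ k)\<^sup>2) + 2 * a * b * s * (\<Sum>k\<in>UNIV. r $ k) + ?n * (b * s)\<^sup>2"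
      by (simp add: power2_sum power_mult_distrib sum.distrib sum_distrib_left algebra_simps)
    also have "(\<Sum>k\<in>UNIV. (r $ k)\<^sup>2) = (norm r)\<^sup>2"
      by (simp add: norm_vec_def L2_set_def sum_nonneg)
    also have "(\<Sum>k\<in>UNIV. r $ k) = s"
      unfolding s_def o ..
    finally have "(\<Sum>j\<in>vertex_indices u. (r \<bullet> u j)\<^sup>2)
        = a\<^sup>2 * (norm r)\<^sup>2 + (2 * a * b + ?n * b\<^sup>2 + d\<^sup>2) * s\<^sup>2"
      by (simp add: algebra_simps power2_eq_square)
    also have "2 * a * b + ?n * b\<^sup>2 + d\<^sup>2 = 0"
      unfolding ab d2 by simp
    finally show ?thesis
      by (simp add: a2 add_divide_distrib)
  qed
  moreover have "norm (u j) = 1" if "j \<in> vertex_indices u" for j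
    using gram[OF that that] by (simp add: norm_eq_1)
  ultimately have "regular_simplex u"
    unfolding regular_simplex_def using gram by metis
  then show ?thesis by blast
qed

lemma norm_sum_regular_simplex:
  fixes u :: "nat \<Rightarrow> real ^ 'n"
  assumes u: "regular_simplex u" and J: "J \<subseteq> vertex_indices u"
  shows "(norm (sum u J))\<^sup>2 = real (card J) * (real CARD('n) + 1 - real (card J)) / real CARD('n)"
proof -
  let ?n = "real CARD('n)"
  have fin: "finite J"
    by (rule finite_subset[OF J finite_vertex_indices])
  have "(\<Sum>j\<in>J. u i \<bullet> u j) = (?n + 1 - real (card J)) / ?n" if "i \<in> J" for i
  proof -
    have "u i \<bullet> u i = 1"
      using regular_simplexD(1)[OF u, of i] J that by (auto simp: norm_eq_1)
    moreover have "(\<Sum>j\<in>J - {i}. u i \<bullet> u j) = (\<Sum>j\<in>J - {i}. - 1 / ?n)"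
    proof (rule sum.cong)
      show "u i \<bullet> u j = - 1 / ?n" if "j \<in> J - {i}" for j
        using J \<open>i \<in> J\<close> that by (intro regular_simplexD(2)[OF u]) auto
    qed simp
    moreover have "real (card (J - {i})) = real (card J) - 1"
      using card_Suc_Diff1[OF fin that] by linarith
    ultimately show ?thesis
      using that fin by (simp add: sum.remove field_simps)
  qed
  then have "(\<Sum>i\<in>J. \<Sum>j\<in>J. u i \<bullet> u j) = (\<Sum>i\<in>J. (?n + 1 - real (card J)) / ?n)"
    by (intro sum.cong) auto
  then show ?thesis
    by (simp add: power2_norm_eq_inner inner_sum_left inner_sum_right inner_commute)
qed

lemma sum_regular_simplex_eq_0:
  "regular_simplex u \<Longrightarrow> sum u (vertex_indices u) = 0"
  using norm_sum_regular_simplex[of u "vertex_indices u"] by simp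

text \<open>
  The cross terms cancel because the vertices sum to zero, and the tight frame condition, applied to
  each row of \<open>M\<close>, evaluates the quadratic terms.
\<close>

lemma sum_norm_affine_regular_simplex:
  fixes u :: "nat \<Rightarrow> real ^ 'n" and M :: "real ^ 'n ^ 'n"
  assumes u: "regular_simplex u"
  shows "(\<Sum>j\<in>vertex_indices u. (norm (w + M *v u j))\<^sup>2)
       = (real CARD('n) + 1) * ((norm w)\<^sup>2 + (norm M)\<^sup>2 / real CARD('n))"
proof -
  let ?n = "real CARD('n)" and ?I = "vertex_indices u"
  have "(\<Sum>j\<in>?I. (norm (w + M *v u j))\<^sup>2)
      = (\<Sum>j\<in>?I. (norm w)\<^sup>2 + 2 * (w \<bullet> (M *v u j)) + (norm (M *v u j))\<^sup>2)"
    by (simp add: power2_norm_eq_inner inner_add_left inner_add_right inner_commute algebra_simps)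
  also have "\<dots> = (?n + 1) * (norm w)\<^sup>2 + 2 * (w \<bullet> (\<Sum>j\<in>?I. M *v u j)) + (\<Sum>j\<in>?I. (norm (M *v u j))\<^sup>2)"
    by (simp add: sum.distrib inner_sum_right sum_distrib_left)
  also have "(\<Sum>j\<in>?I. M *v u j) = 0"
    using sum_regular_simplex_eq_0[OF u] linear_sum[of "(*v) M" u ?I] by simp
  also have "(\<Sum>j\<in>?I. (norm (M *v u j))\<^sup>2) = (\<Sum>j\<in>?I. \<Sum>i\<in>UNIV. (M $ i \<bullet> u j)\<^sup>2)"
    by (simp add: norm_vec_def L2_set_def sum_nonneg matrix_vector_mul_component)
  also have "\<dots> = (\<Sum>i\<in>UNIV. \<Sum>j\<in>?I. (M $ i \<bullet> u j)\<^sup>2)"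
    by (rule sum.swap)
  also have "\<dots> = (?n + 1) / ?n * (norm M)\<^sup>2"
    by (simp only: regular_simplexD(3)[OF u] norm_matrix_eq sum_distrib_left)
  finally show ?thesis
    by (simp add: algebra_simps add_divide_distrib)
qed

lemma regular_simplex_in_ball:
  fixes u :: "nat \<Rightarrow> real ^ 'n" and M :: "real ^ 'n ^ 'n"
  assumes u: "regular_simplex u" and le: "\<And>j. j \<in> vertex_indices u \<Longrightarrow> norm (w + M *v u j) \<le> 1"
  shows "(norm w)\<^sup>2 + (norm M)\<^sup>2 / real CARD('n) \<le> 1"
proof -
  have "(\<Sum>j\<in>vertex_indices u. (norm (w + M *v u j))\<^sup>2) \<le> (\<Sum>j\<in>vertex_indices u. 1)"
    using le by (intro sum_mono) (auto simp: power_le_one)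
  then have "(real CARD('n) + 1) * ((norm w)\<^sup>2 + (norm M)\<^sup>2 / real CARD('n)) \<le> (real CARD('n) + 1) * 1"
    unfolding sum_norm_affine_regular_simplex[OF u] by (simp add: add.commute)
  then show ?thesis
    by (rule mult_left_le_imp_le) simp
qed

text \<open>
  Every simplex is an affine image of a regular one. By the Gram relations of \<open>u\<close>, the linear part
  can be written down directly as \<open>v \<mapsto> n / (n + 1) * (\<Sum>j. (u j \<bullet> v) (x j - c))\<close>; it is surjective
  since the vertices of the simplex affinely span the space.
\<close>

lemma ex_affine_map_from_regular_simplex:
  fixes x u :: "nat \<Rightarrow> real ^ 'n"
  assumes x: "nondegenerate_simplex x" and u: "regular_simplex u"
  defines "c \<equiv> gravity_center x (vertex_indices x)"
  shows "\<exists>T :: real ^ 'n ^ 'n. invertible T \<and> (\<forall>j\<in>vertex_indices x. x j = c + T *v u j)"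
proof -
  let ?n = "real CARD('n)" and ?I = "vertex_indices x"
  have I: "vertex_indices u = ?I"
    by (rule vertex_indices_cong)
  define f where "f v = (?n / (?n + 1)) *\<^sub>R (\<Sum>j\<in>?I. (u j \<bullet> v) *\<^sub>R (x j - c))" for v
  have "linear f"
    by (rule linearI) (simp_all add: f_def inner_add_right scaleR_add_left scaleR_add_right sum.distrib
        scaleR_sum_right mult.assoc mult.left_commute)
  then have T: "matrix f *v v = f v" for v
    by (simp add: matrix_works linear_def)
  have "(\<Sum>j\<in>?I. x j - c) = 0"
    by (simp add: sum_subtractf c_def gravity_center_def sum_constant_scaleR del: sum_constant)
  then have sum0: "(\<Sum>j\<in>?I - {i}. x j - c) = - (x i - c)" if "i \<in> ?I" for i
    using that by (simp add: sum.remove add_eq_0_iff)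
  have fu: "x i = c + f (u i)" if i: "i \<in> ?I" for i
  proof -
    have "u i \<bullet> u i = 1"
      using regular_simplexD(1)[OF u, of i] i by (simp add: norm_eq_1 I)
    moreover have "(\<Sum>j\<in>?I - {i}. (u j \<bullet> u i) *\<^sub>R (x j - c)) = (\<Sum>j\<in>?I - {i}. (- 1 / ?n) *\<^sub>R (x j - c))"
      using i by (intro sum.cong arg_cong2[where f = scaleR] regular_simplexD(2)[OF u]) (auto simp: I)
    ultimately have "(\<Sum>j\<in>?I. (u j \<bullet> u i) *\<^sub>R (x j - c)) = (x i - c) + (1 / ?n) *\<^sub>R (x i - c)"
      using i sum0[OF i] unfolding scaleR_sum_right[symmetric]
      by (simp add: sum.remove algebra_simps)
    also have "\<dots> = ((?n + 1) / ?n) *\<^sub>R (x i - c)"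
      by (simp add: add_divide_distrib scaleR_add_left)
    finally show ?thesis
      by (simp add: f_def)
  qed
  have "affine hull (x ` ?I) = UNIV"
    using x by (intro affine_independent_span_eq)
      (auto simp: nondegenerate_simplex_def card_image)
  moreover have "affine ((+) c ` range f)"
    using \<open>linear f\<close> affine_translation linear_subspace_image subspace_UNIV subspace_imp_affine by blast
  moreover have "x ` ?I \<subseteq> (+) c ` range f"
    using fu by auto
  ultimately have "(+) c ` range f = UNIV"
    using hull_minimal[of "x ` ?I" "(+) c ` range f" affine] by auto
  then have "c + y \<in> (+) c ` range f" for y
    by simp
  then have "y \<in> range f" for y
    by (metis (no_types, lifting) add_left_cancel imageE)
  then have "surj f"
    by blast
  then have "surj ((*v) (matrix f))"
    by (simp add: T[abs_def])
  then have "invertible (matrix f)"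
    by (simp add: invertible_right_inverse matrix_right_invertible_surjective)
  then show ?thesis
    using fu by (intro exI[of _ "matrix f"]) (simp add: T)
qed

section \<open>The minimal ellipsoid of a simplex and the exit points\<close>

text \<open>
  The image of the closed unit ball under \<open>v \<mapsto> c + A v\<close>; it is an ellipsoid when \<open>A\<close> is invertible.
\<close>

abbreviation affine_ball_image :: "real ^ 'n \<Rightarrow> real ^ 'n ^ 'n \<Rightarrow> (real ^ 'n) set" where
  "affine_ball_image c A \<equiv> (\<lambda>v. c + A *v v) ` cball 0 1"

lemma measure_affine_ball_image:
  "measure lebesgue (affine_ball_image c A) = \<bar>det A\<bar> * measure lebesgue (cball (0 :: real ^ 'n) 1)"
  for A :: "real ^ 'n ^ 'n"
proof -
  have "affine_ball_image c A = (+) c ` (*v) A ` cball 0 1"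
    by (simp add: image_image)
  then show ?thesis
    by (simp only: measure_translation measure_matrix_image lmeasurable_cball)
qed

text \<open>
  Pulling back by the second ellipsoid turns the vertices of the simplex into the points \<open>w + M u\<^sub>j\<close> of
  the unit ball, where \<open>M = inverse(A) T\<close>. Averaging their squared norms bounds the Frobenius norm of \<open>M\<close>
  by the square root of the dimension, so that \<open>\<bar>det M\<bar> \<le> 1\<close>; in the case of equality, \<open>w = 0\<close> and \<open>M\<close> is
  orthogonal, and the two ellipsoids coincide.
\<close>

lemma ellipsoid_around_simplex:
  fixes x u :: "nat \<Rightarrow> real ^ 'n" and A T :: "real ^ 'n ^ 'n"
  assumes u: "regular_simplex u" and T: "invertible T"
    and x: "\<And>j. j \<in> vertex_indices x \<Longrightarrow> x j = c + T *v u j"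
    and A: "invertible A" and sub: "simplex_hull x \<subseteq> affine_ball_image d A"
  shows "\<bar>det T\<bar> \<le> \<bar>det A\<bar>"
    and "\<bar>det A\<bar> \<le> \<bar>det T\<bar> \<Longrightarrow> affine_ball_image d A = affine_ball_image c T"
proof -
  let ?n = "real CARD('n)"
  obtain B where B: "A ** B = mat 1" "B ** A = mat 1"
    using A unfolding invertible_def by blast
  define M w where "M = B ** T" and "w = B *v (c - d)"
  have T_eq: "T = A ** M"
    by (simp add: M_def matrix_mul_assoc B)
  have det: "\<bar>det T\<bar> = \<bar>det A\<bar> * \<bar>det M\<bar>"
    by (simp add: T_eq det_mul abs_mult)
  have detA: "\<bar>det A\<bar> > 0"
    using A by (simp add: invertible_det_nz)
  have "norm (w + M *v u j) \<le> 1" if j: "j \<in> vertex_indices u" for j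
  proof -
    have j': "j \<in> vertex_indices x"
      using j vertex_indices_cong by metis
    then have "x j \<in> simplex_hull x"
      by (simp add: simplex_hull_def hull_inc)
    then obtain v where v: "norm v \<le> 1" "x j = d + A *v v"
      using sub by auto
    have "w + M *v u j = B *v (x j - d)"
      using x[OF j'] by (simp add: w_def M_def algebra_simps flip: matrix_vector_mul_assoc)
    also have "\<dots> = v"
      by (simp add: v(2) matrix_vector_mul_assoc B)
    finally show ?thesis
      using v(1) by simp
  qed
  from regular_simplex_in_ball[OF u this]
  have wM: "(norm w)\<^sup>2 + (norm M)\<^sup>2 / ?n \<le> 1" .
  then have "(norm M)\<^sup>2 / ?n \<le> 1"
    by (smt (verit) zero_le_power2)
  then have M: "(norm M)\<^sup>2 \<le> ?n"
    by simp
  show "\<bar>det T\<bar> \<le> \<bar>det A\<bar>"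
    unfolding det using det_le_1_of_norm_le(1)[OF M] by (simp add: mult_left_le)
  assume "\<bar>det A\<bar> \<le> \<bar>det T\<bar>"
  then have "\<bar>det M\<bar> = 1"
    using detA det_le_1_of_norm_le(1)[OF M] by (simp add: det)
  then have orth: "orthogonal_matrix M" and nM: "(norm M)\<^sup>2 = ?n"
    using det_le_1_of_norm_le(2)[OF M] by auto
  have "w = 0"
    using wM by (simp add: nM)
  have "c - d = A *v w"
    by (simp add: w_def matrix_vector_mul_assoc B)
  then have "d = c"
    using \<open>w = 0\<close> by simp
  have "orthogonal_transformation ((*v) M)"
    using orth by (simp add: orthogonal_transformation_matrix)
  then have "(*v) M ` cball 0 1 = cball 0 1"
    using image_orthogonal_transformation_cball[of "(*v) M" 0 1] by simp
  then have "affine_ball_image c A = (\<lambda>v. c + A *v v) ` (*v) M ` cball 0 1"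
    by simp
  also have "\<dots> = affine_ball_image c T"
    unfolding image_image by (simp add: T_eq matrix_vector_mul_assoc)
  finally show "affine_ball_image d A = affine_ball_image c T"
    using \<open>d = c\<close> by simp
qed

lemma min_ellipsoid_simplex:
  fixes x u :: "nat \<Rightarrow> real ^ 'n" and T :: "real ^ 'n ^ 'n"
  assumes u: "regular_simplex u" and T: "invertible T"
    and x: "\<And>j. j \<in> vertex_indices x \<Longrightarrow> x j = c + T *v u j"
  shows "min_ellipsoid (simplex_hull x) = affine_ball_image c T"
proof -
  let ?E = "affine_ball_image c T"
  have ell: "ellipsoid ?E"
    using T by (auto simp: ellipsoid_def)
  have "?E = (+) c ` (*v) T ` cball 0 1"
    by (simp add: image_image)
  then have "convex ?E"
    by (simp only: convex_translation convex_linear_image matrix_vector_mul_linear convex_cball)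
  moreover have "x ` vertex_indices x \<subseteq> ?E"
  proof
    fix y assume "y \<in> x ` vertex_indices x"
    then obtain j where j: "j \<in> vertex_indices x" "y = x j" by auto
    then have "norm (u j) = 1"
      using u vertex_indices_cong[of x u] by (simp add: regular_simplex_def)
    then show "y \<in> ?E"
      using x j by auto
  qed
  ultimately have sub: "simplex_hull x \<subseteq> ?E"
    unfolding simplex_hull_def by (intro hull_minimal)
  have vol: "measure lebesgue (cball (0 :: real ^ 'n) 1) > 0"
    by (simp add: content_cball_gt_0_iff)
  have "is_min_ellipsoid (simplex_hull x) ?E"
    unfolding is_min_ellipsoid_def
  proof (intro conjI ell sub allI impI)
    fix E' assume E': "ellipsoid E' \<and> simplex_hull x \<subseteq> E'"
    then obtain A d where A: "invertible A" "E' = affine_ball_image d A"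
      unfolding ellipsoid_def by blast
    then have "\<bar>det T\<bar> \<le> \<bar>det A\<bar>"
      using ellipsoid_around_simplex(1)[OF u T x A(1)] E' by blast
    then show "measure lebesgue ?E \<le> measure lebesgue E'"
      using vol by (simp add: A measure_affine_ball_image)
  qed
  moreover have "E' = ?E" if E': "is_min_ellipsoid (simplex_hull x) E'" for E'
  proof -
    obtain A d where A: "invertible A" "E' = affine_ball_image d A"
      using E' unfolding is_min_ellipsoid_def ellipsoid_def by blast
    have "measure lebesgue E' \<le> measure lebesgue ?E"
      using E' ell sub unfolding is_min_ellipsoid_def by blast
    then have "\<bar>det A\<bar> \<le> \<bar>det T\<bar>"
      using vol by (simp add: A measure_affine_ball_image)
    moreover have "simplex_hull x \<subseteq> affine_ball_image d A"
      using E' A(2) unfolding is_min_ellipsoid_def by blast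
    ultimately show ?thesis
      using ellipsoid_around_simplex(2)[OF u T x A(1)] A(2) by blast
  qed
  ultimately show ?thesis
    unfolding min_ellipsoid_def by (rule the_equality)
qed

lemma frontier_affine_ball_image:
  fixes T :: "real ^ 'n ^ 'n"
  assumes T: "invertible T"
  shows "c + T *v p \<in> frontier (affine_ball_image c T) \<longleftrightarrow> norm p = 1"
proof -
  have inj: "inj ((*v) T)"
    using T by (rule inj_matrix_vector_mult)
  have "affine_ball_image c T = (+) c ` (*v) T ` cball 0 1"
    by (simp add: image_image)
  then have "frontier (affine_ball_image c T) = (+) c ` frontier ((*v) T ` cball 0 1)"
    by (simp only: frontier_translation)
  also have "frontier ((*v) T ` cball 0 1) = (*v) T ` (cball 0 1 - ball 0 1)"
    by (simp add: frontier_def image_set_diff[OF inj]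
        interior_injective_linear_image[OF matrix_vector_mul_linear inj]
        flip: closure_injective_linear_image[OF matrix_vector_mul_linear inj])
  finally show ?thesis
    using inj by (auto simp: inj_eq)
qed

text \<open>
  In the coordinates in which the minimal ellipsoid is the unit ball, the line joining the two
  centers of gravity passes through the origin, and \<open>g\<^sub>J\<close> has norm \<open>1 / s\<close>. The exit point is therefore
  the image of \<open>- s g\<^sub>J\<close>.
\<close>

lemma exit_point_eq:
  fixes x :: "nat \<Rightarrow> real ^ 'n"
  assumes x: "nondegenerate_simplex x"
    and J: "J \<subseteq> vertex_indices x" "1 \<le> card J" "card J \<le> CARD('n)"
  defines "c \<equiv> gravity_center x (vertex_indices x)"
    and "s \<equiv> sqrt (real CARD('n) * real (card J) / (real CARD('n) + 1 - real (card J)))"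
  shows "exit_point x J = c - s *\<^sub>R (gravity_center x J - c)"
proof -
  let ?n = "real CARD('n)" and ?I = "vertex_indices x"
  define k l where "k = real (card J)" and "l = ?n + 1 - k"
  have k: "k \<ge> 1" and l: "l \<ge> 1"
    using J by (auto simp: k_def l_def)
  obtain u :: "nat \<Rightarrow> real ^ 'n" where u: "regular_simplex u"
    using ex_regular_simplex by blast
  obtain T :: "real ^ 'n ^ 'n" where T: "invertible T" and xT: "\<And>j. j \<in> ?I \<Longrightarrow> x j = c + T *v u j"
    using ex_affine_map_from_regular_simplex[OF x u] unfolding c_def by blast
  have I: "vertex_indices u = ?I"
    by (rule vertex_indices_cong)
  have finJ: "finite J"
    by (rule finite_subset[OF J(1) finite_vertex_indices])
  have gc: "gravity_center x K = c + T *v ((1 / real (card K)) *\<^sub>R sum u K)"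
    if K: "K \<subseteq> ?I" "card K \<ge> 1" for K
  proof -
    have "sum x K = (\<Sum>j\<in>K. c + T *v u j)"
      using K xT by (intro sum.cong) auto
    also have "\<dots> = real (card K) *\<^sub>R c + T *v sum u K"
      using linear_sum[of "(*v) T" u K] by (simp add: sum.distrib sum_constant_scaleR del: sum_constant)
    finally show ?thesis
      using K by (simp add: gravity_center_def scaleR_add_right matrix_vector_mult_scaleR)
  qed
  define \<gamma> where "\<gamma> = (1 / k) *\<^sub>R sum u J"
  have g: "gravity_center x J = c + T *v \<gamma>"
    using gc[OF J(1,2)] by (simp add: \<gamma>_def k_def)
  have cardJ': "real (card (?I - J)) = l"
    using J finJ by (simp add: card_Diff_subset k_def l_def of_nat_diff)
  have "sum u (?I - J) = - sum u J"
    using sum_regular_simplex_eq_0[OF u] J(1) by (simp add: sum_diff I)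
  also have "sum u J = k *\<^sub>R \<gamma>"
    using k by (simp add: \<gamma>_def)
  finally have "sum u (?I - J) = - (k *\<^sub>R \<gamma>)" .
  then have h: "gravity_center x (?I - J) = c + T *v (- (k / l) *\<^sub>R \<gamma>)"
    using gc[of "?I - J"] cardJ' l by simp
  have s: "s > 0" "s\<^sup>2 = ?n * k / l"
    using k l by (simp_all add: s_def k_def l_def)
  have "(norm \<gamma>)\<^sup>2 = (1 / s)\<^sup>2"
    using norm_sum_regular_simplex[OF u, of J] J(1) k l
    by (simp add: \<gamma>_def power_mult_distrib power_divide s I k_def[symmetric] l_def[symmetric])
       (simp add: power2_eq_square)
  then have \<gamma>: "norm \<gamma> = 1 / s"
    using s(1) by simp
  \<comment> \<open>The line is parametrized by \<open>c + T *v p t\<close>; it meets the frontier where \<open>norm (p t) = 1\<close>.\<close>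
  define p where "p t = (1 - t * ((?n + 1) / l)) *\<^sub>R \<gamma>" for t
  have "1 + k / l = (?n + 1) / l"
    using l by (simp add: l_def field_simps)
  then have "p t = (1 - t * (1 + k / l)) *\<^sub>R \<gamma>" for t
    by (simp only: p_def)
  moreover have "(1 - t * (1 + r)) *\<^sub>R \<gamma> = \<gamma> + t *\<^sub>R (- r *\<^sub>R \<gamma> - \<gamma>)" for r t
    by (simp add: algebra_simps)
  ultimately have "p t = \<gamma> + t *\<^sub>R (- (k / l) *\<^sub>R \<gamma> - \<gamma>)" for t
    by (simp only:)
  then have "T *v p t = T *v \<gamma> + t *\<^sub>R (T *v (- (k / l) *\<^sub>R \<gamma>) - T *v \<gamma>)" for t
    by (simp only: matrix_vector_right_distrib matrix_vector_mult_scaleR matrix_vector_mult_diff_distrib)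
  then have line: "gravity_center x J + t *\<^sub>R (gravity_center x (?I - J) - gravity_center x J) = c + T *v p t" for t
    unfolding g h by simp
  have E: "min_ellipsoid (simplex_hull x) = affine_ball_image c T"
    by (rule min_ellipsoid_simplex[OF u T]) (rule xT)
  have "norm (p t) = 1 \<longleftrightarrow> \<bar>1 - t * ((?n + 1) / l)\<bar> = s" for t
    using s(1) by (auto simp: p_def \<gamma>)
  then have frontier: "c + T *v p t \<in> frontier (min_ellipsoid (simplex_hull x)) \<longleftrightarrow> \<bar>1 - t * ((?n + 1) / l)\<bar> = s" for t
    by (simp only: E frontier_affine_ball_image[OF T])
  \<comment> \<open>The larger of the two solutions.\<close>
  define t0 where "t0 = (1 + s) * l / (?n + 1)"
  have r: "(?n + 1) / l > 0"
    using l by simp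
  have t0: "t0 * ((?n + 1) / l) = 1 + s"
    using l by (simp add: t0_def)
  have "(GREATEST t. \<bar>1 - t * ((?n + 1) / l)\<bar> = s) = t0"
  proof (rule Greatest_equality)
    show "\<bar>1 - t0 * ((?n + 1) / l)\<bar> = s"
      using s(1) by (simp only: t0)
    show "t \<le> t0" if "\<bar>1 - t * ((?n + 1) / l)\<bar> = s" for t
    proof -
      have "t * ((?n + 1) / l) \<le> t0 * ((?n + 1) / l)"
        unfolding t0 using that by linarith
      then show ?thesis
        using r by (rule mult_right_le_imp_le)
    qed
  qed
  then have "exit_point x J = c + T *v p t0"
    by (simp add: exit_point_def Let_def line frontier)
  also have "p t0 = - (s *\<^sub>R \<gamma>)"
    unfolding p_def t0 by simp
  also have "c + T *v (- (s *\<^sub>R \<gamma>)) = c - s *\<^sub>R (gravity_center x J - c)"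
    unfolding g by (simp add: matrix_vector_mult_scaleR flip: scaleR_minus_left)
  finally show ?thesis .
qed

section \<open>Averaging over subsets of fixed size\<close>

text \<open>
  The right-hand side is the mean of the left-hand side over all \<open>r\<close>-element subsets \<open>R\<close> of \<open>V\<close>. A good
  subset is found by removing one element at a time: the mean of the functional with parameters
  \<open>B\<close>, \<open>C\<close> over all removals from a set with \<open>r + 1\<close> elements is, up to the constant \<open>C\<close>, the
  functional with parameters \<open>r / (r + 1) * B\<close>, \<open>(r - 1) / (r + 1) * C\<close> on that set, to which the
  induction hypothesis applies.
\<close>

lemma exists_subset_le_average:
  fixes v :: "'b \<Rightarrow> 'a :: real_inner"
  assumes V: "finite V" "card V = N" "2 \<le> N" and unit: "\<And>j. j \<in> V \<Longrightarrow> norm (v j) = 1"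
    and r: "1 \<le> r" "r \<le> N"
  shows "\<exists>R\<subseteq>V. card R = r \<and>
           B \<bullet> sum v R + C * (norm (sum v R))\<^sup>2
         \<le> r / N * (B \<bullet> sum v V)
           + C * (r * (real r - 1) / (N * (real N - 1)) * (norm (sum v V))\<^sup>2 + r * (real N - r) / (real N - 1))"
  using r(2,1)
proof (induction r arbitrary: B C rule: inc_induct)
  case base
  show ?case
    using V by (intro exI[of _ V]) simp
next
  case (step r)
  define q where "q = real r"
  have q: "q \<ge> 1"
    using step.prems by (simp add: q_def)
  have N: "real N > 1"
    using V by simp
  let ?T = "sum v V"
  obtain R where R: "R \<subseteq> V" "card R = Suc r"
    and le: "(q / (q + 1)) *\<^sub>R B \<bullet> sum v R + (q - 1) / (q + 1) * C * (norm (sum v R))\<^sup>2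
         \<le> (q + 1) / N * ((q / (q + 1)) *\<^sub>R B \<bullet> ?T)
           + (q - 1) / (q + 1) * C * ((q + 1) * q / (N * (real N - 1)) * (norm ?T)\<^sup>2
             + (q + 1) * (real N - (q + 1)) / (real N - 1))"
    using step.IH[of "(q / (q + 1)) *\<^sub>R B" "(q - 1) / (q + 1) * C"]
    by (auto simp: q_def add.commute)
  let ?W = "sum v R"
  have fin: "finite R"
    using R V finite_subset by blast
  define f where "f a = B \<bullet> sum v (R - {a}) + C * (norm (sum v (R - {a})))\<^sup>2" for a
  have f: "f a = B \<bullet> ?W - B \<bullet> v a + C * ((norm ?W)\<^sup>2 - 2 * (?W \<bullet> v a) + 1)" if "a \<in> R" for a
  proof -
    have "v a \<bullet> v a = 1"
      using unit[of a] that R by (auto simp: norm_eq_1)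
    then show ?thesis
      using that fin by (simp add: f_def sum_diff1 power2_norm_eq_inner inner_diff inner_commute)
  qed
  have "sum f R = (\<Sum>a\<in>R. B \<bullet> ?W - B \<bullet> v a + C * ((norm ?W)\<^sup>2 - 2 * (?W \<bullet> v a) + 1))"
    by (rule sum.cong) (use f in auto)
  also have "\<dots> = (q + 1) * (B \<bullet> ?W) - B \<bullet> ?W + C * ((q + 1) * (norm ?W)\<^sup>2 - 2 * (?W \<bullet> ?W) + (q + 1))"
    using R(2) by (simp add: sum.distrib sum_subtractf q_def inner_sum_right[symmetric]
        sum_distrib_left[symmetric] add.commute)
  also have "\<dots> = q * (B \<bullet> ?W) + C * ((q - 1) * (norm ?W)\<^sup>2 + (q + 1))"
    by (simp add: power2_norm_eq_inner algebra_simps)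
  finally have sumf: "sum f R = \<dots>" .
  have "\<exists>a\<in>R. f a \<le> sum f R / (q + 1)"
  proof (rule ccontr)
    assume "\<not> ?thesis"
    then have "(\<Sum>a\<in>R. sum f R / (q + 1)) < sum f R"
      using R fin by (intro sum_strict_mono) (auto simp: not_le)
    then show False
      using R(2) q by (simp add: q_def add.commute)
  qed
  then obtain a where a: "a \<in> R" "f a \<le> sum f R / (q + 1)" by blast
  note a(2)
  also have "sum f R / (q + 1) = ((q / (q + 1)) *\<^sub>R B \<bullet> ?W + (q - 1) / (q + 1) * C * (norm ?W)\<^sup>2) + C"
  proof -
    have "(q * b + C * ((q - 1) * w + (q + 1))) / (q + 1)
        = q / (q + 1) * b + (q - 1) / (q + 1) * C * w + C" for b w
    proof -
      have "q / d * b + (q - 1) / d * C * w + d / d * C = (q * b + C * ((q - 1) * w + d)) / d" for d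
        by (simp add: add_divide_distrib algebra_simps diff_divide_distrib)
      from this[of "q + 1"] show ?thesis
        using q by simp
    qed
    then show ?thesis
      unfolding sumf by simp
  qed
  also have "\<dots> \<le> ((q + 1) / N * ((q / (q + 1)) *\<^sub>R B \<bullet> ?T)
           + (q - 1) / (q + 1) * C * ((q + 1) * q / (N * (real N - 1)) * (norm ?T)\<^sup>2
             + (q + 1) * (real N - (q + 1)) / (real N - 1))) + C"
    using le by simp
  also have "\<dots> = q / N * (B \<bullet> ?T) + C * (q * (q - 1) / (N * (real N - 1)) * (norm ?T)\<^sup>2
      + ((q - 1) * (real N - (q + 1)) / (real N - 1) + 1))"
  proof -
    have 1: "(q + 1) / N * ((q / (q + 1)) *\<^sub>R B \<bullet> ?T) = q / N * (B \<bullet> ?T)"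
      using q by simp
    have 2: "(q - 1) / d * C * (d * x / y * z + d * u / w) = C * (x * (q - 1) / y * z + (q - 1) * u / w)"
      if "d \<noteq> 0" for d x y z u w
      using that by (simp add: algebra_simps add_divide_distrib diff_divide_distrib)
    have 3: "q + 1 \<noteq> 0" using q by simp
    show ?thesis unfolding 1 2[OF 3] by (simp add: algebra_simps)
  qed
  also have "(q - 1) * (real N - (q + 1)) / (real N - 1) + 1 = q * (real N - q) / (real N - 1)"
    using N by (simp add: field_simps)
  finally have "f a \<le> q / N * (B \<bullet> ?T)
      + C * (q * (q - 1) / (N * (real N - 1)) * (norm ?T)\<^sup>2 + q * (real N - q) / (real N - 1))" .
  moreover have "R - {a} \<subseteq> V" "card (R - {a}) = r"
    using R a fin by auto
  ultimately show ?case
    unfolding f_def q_def by blast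
qed

section \<open>Suitable faces containing a suitable vertex\<close>

text \<open>
  With \<open>l = n + 1 - k\<close> the claim is \<open>\<mu> (k - l) \<le> n - 1\<close>. After squaring and using \<open>\<mu>\<^sup>2 k l = n\<close> it
  becomes \<open>n \<le> k l\<close>, which is \<open>0 \<le> (k - 1) (l - 1)\<close>.
\<close>

lemma average_coefficient_nonneg:
  fixes n k \<mu> :: real
  assumes "1 \<le> k" "k \<le> n" and \<mu>: "\<mu> \<ge> 0" "\<mu>\<^sup>2 * k * (n + 1 - k) = n"
  shows "0 \<le> (1 + \<mu> * k) * (n - 1) - \<mu> * ((k - 1) * (n + 1))"
proof -
  define l where "l = n + 1 - k"
  have l: "l \<ge> 1"
    using assms by (simp add: l_def)
  have n: "n = k + l - 1"
    by (simp add: l_def)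
  have "0 \<le> (k - 1) * (l - 1)"
    using assms l by simp
  then have kl: "0 \<le> k * l - n"
    by (simp add: n algebra_simps)
  have "(\<mu> * (k - l))\<^sup>2 * (k * l) = (\<mu>\<^sup>2 * k * l) * (k - l)\<^sup>2"
    by (simp add: power_mult_distrib)
  also have "\<dots> = n * (k - l)\<^sup>2"
    using \<mu>(2) by (simp add: l_def)
  also have "\<dots> = (n - 1)\<^sup>2 * (k * l) - (k * l - n) * (n + 1)\<^sup>2"
    unfolding n by algebra
  also have "\<dots> \<le> (n - 1)\<^sup>2 * (k * l)"
    using kl by simp
  finally have "(\<mu> * (k - l))\<^sup>2 \<le> (n - 1)\<^sup>2"
    using l assms(1) by (simp add: mult_le_cancel_right)
  then have "\<mu> * (k - l) \<le> n - 1"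
    by (rule power2_le_imp_le) (use assms(1,2) in simp)
  moreover have "(1 + \<mu> * k) * (n - 1) - \<mu> * ((k - 1) * (n + 1)) = (n - 1) - \<mu> * (k - l)"
    by (simp add: l_def algebra_simps)
  ultimately show ?thesis
    by simp
qed

text \<open>
  The left-hand side is the mean of the squared norm of the exit point over all faces with \<open>k\<close>
  vertices that contain \<open>x\<^sub>i\<close>, where \<open>p = c \<bullet> x\<^sub>i\<close>, \<open>q = c \<bullet> c\<close> and \<open>\<mu> = s / k\<close>.
\<close>

lemma average_identity:
  fixes n k \<mu> p q :: real
  assumes nz: "n \<noteq> 0" "n \<noteq> 1" and e: "\<mu>\<^sup>2 * k * (n + 1 - k) = n"
  shows "(1 + \<mu> * k)\<^sup>2 * q - 2 * (1 + \<mu> * k) * \<mu> * p + \<mu>\<^sup>2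
       + (k - 1) / n * (- 2 * \<mu> * ((1 + \<mu> * k) * ((n + 1) * q - p) - \<mu> * ((n + 1) * p - 1)))
       + \<mu>\<^sup>2 * ((k - 1) * (k - 2) / (n * (n - 1)) * ((n + 1)\<^sup>2 * q - 2 * (n + 1) * p + 1)
                 + (k - 1) * (n - (k - 1)) / (n - 1))
     = 1 - 2 * \<mu> * (n + 1 - k) * ((1 + \<mu> * k) * (n - 1) - \<mu> * ((k - 1) * (n + 1))) * (p - q) / (n * (n - 1))"
    (is "?L = 1 - ?D / (n * (n - 1))")
proof -
  have clear: "n * h * (a + b / n * c + d * (e / (n * h) * f + g / h))
      = n * h * a + h * b * c + d * (e * f + n * g)" if "h \<noteq> 0" for a b c d e f g h
    using nz(1) that by (simp add: field_simps)
  have "n * (n - 1) * ?L = n * (n - 1) * ((1 + \<mu> * k)\<^sup>2 * q - 2 * (1 + \<mu> * k) * \<mu> * p + \<mu>\<^sup>2)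
       + (n - 1) * (k - 1) * (- 2 * \<mu> * ((1 + \<mu> * k) * ((n + 1) * q - p) - \<mu> * ((n + 1) * p - 1)))
       + \<mu>\<^sup>2 * ((k - 1) * (k - 2) * ((n + 1)\<^sup>2 * q - 2 * (n + 1) * p + 1)
                 + n * ((k - 1) * (n - (k - 1))))"
    by (rule clear) (use nz in simp)
  also have "\<dots> = n * (n - 1) - ?D + (n - 1) * (1 - q) * (\<mu>\<^sup>2 * k * (n + 1 - k) - n)"
    by algebra
  finally have "n * (n - 1) * ?L = n * (n - 1) - ?D"
    by (simp add: e)
  moreover have "L = 1 - D / N" if "N * L = N - D" "N \<noteq> 0" for L D N :: real
    using that by (simp add: field_simps)
  ultimately show ?thesis
    using nz by simp
qed

lemma average_le_1:
  fixes n k \<mu> p q :: real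
  assumes k: "1 \<le> k" "k \<le> n" "1 < n" and \<mu>: "\<mu> \<ge> 0" "\<mu>\<^sup>2 * k * (n + 1 - k) = n" and "q \<le> p"
  shows "(1 + \<mu> * k)\<^sup>2 * q - 2 * (1 + \<mu> * k) * \<mu> * p + \<mu>\<^sup>2
       + (k - 1) / n * (- 2 * \<mu> * ((1 + \<mu> * k) * ((n + 1) * q - p) - \<mu> * ((n + 1) * p - 1)))
       + \<mu>\<^sup>2 * ((k - 1) * (k - 2) / (n * (n - 1)) * ((n + 1)\<^sup>2 * q - 2 * (n + 1) * p + 1)
                 + (k - 1) * (n - (k - 1)) / (n - 1)) \<le> 1"
proof -
  have "0 \<le> (1 + \<mu> * k) * (n - 1) - \<mu> * ((k - 1) * (n + 1))"
    by (rule average_coefficient_nonneg[OF k(1,2) \<mu>])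
  then have "0 \<le> 2 * \<mu> * (n + 1 - k) * ((1 + \<mu> * k) * (n - 1) - \<mu> * ((k - 1) * (n + 1))) * (p - q) / (n * (n - 1))"
    using k \<mu>(1) \<open>q \<le> p\<close> by (intro mult_nonneg_nonneg divide_nonneg_nonneg) auto
  then show ?thesis
    using k by (subst average_identity[OF _ _ \<mu>(2)]) auto
qed

lemma suitable_iff_norm:
  fixes x :: "nat \<Rightarrow> real ^ 'n"
  assumes "nondegenerate_simplex x" "J \<subseteq> vertex_indices x" "1 \<le> card J" "card J \<le> CARD('n)"
  defines "c \<equiv> gravity_center x (vertex_indices x)"
    and "s \<equiv> sqrt (real CARD('n) * real (card J) / (real CARD('n) + 1 - real (card J)))"
  shows "suitable x J \<longleftrightarrow> (norm ((1 + s) *\<^sub>R c - s *\<^sub>R gravity_center x J))\<^sup>2 \<le> 1"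
proof -
  have "exit_point x J = c - s *\<^sub>R (gravity_center x J - c)"
    unfolding c_def s_def by (rule exit_point_eq[OF assms(1-4)])
  also have "\<dots> = (1 + s) *\<^sub>R c - s *\<^sub>R gravity_center x J"
    by (simp add: algebra_simps)
  finally show ?thesis
    by (simp add: suitable_def abs_square_le_1)
qed

theorem theorem2:
  fixes x :: "nat \<Rightarrow> real ^ 'n" and i m :: nat
  assumes "nondegenerate_simplex x"
    and "\<forall>j \<in> vertex_indices x. norm (x j) = 1"
    and "i \<in> vertex_indices x"
    and "suitable x {i}"
    and "m \<in> {1..CARD('n) - 1}"
  shows "\<exists>J. J \<subseteq> vertex_indices x \<and> card J = m + 1 \<and> i \<in> J \<and> suitable x J"
proof -
  define n k where "n = real CARD('n)" and "k = real m + 1"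
  define c where "c = gravity_center x (vertex_indices x)"
  define s \<mu> where "s = sqrt (n * k / (n + 1 - k))" and "\<mu> = s / k"
  define p q where "p = c \<bullet> x i" and "q = c \<bullet> c"
  define V where "V = vertex_indices x - {i}"
  have m: "1 \<le> m" "m \<le> CARD('n)" "2 \<le> CARD('n)"
    using assms(5) by auto
  have k: "1 \<le> k" "k \<le> n" "1 < n"
    using assms(5) m by (auto simp: k_def n_def)
  have s: "s \<ge> 0" "s\<^sup>2 * (n + 1 - k) = n * k"
    using k by (simp_all add: s_def)
  have sk: "s = \<mu> * k"
    using k by (simp add: \<mu>_def)
  have "\<mu>\<^sup>2 * k * (n + 1 - k) = n"
    using s(2) k by (simp add: \<mu>_def field_simps power2_eq_square)
  then have \<mu>: "\<mu> \<ge> 0" "\<mu>\<^sup>2 * k * (n + 1 - k) = n"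
    using s(1) k by (simp_all add: \<mu>_def)
  have xi: "x i \<bullet> x i = 1"
    using assms(2,3) by (simp add: norm_eq_1)
  have V: "finite V" "card V = CARD('n)"
    using assms(3) by (auto simp: V_def)
  \<comment> \<open>For a single vertex the scaling factor is 1, so its exit point is its reflection in the center \<open>c\<close>.\<close>
  have "(norm (2 *\<^sub>R c - x i))\<^sup>2 \<le> 1"
    using suitable_iff_norm[OF assms(1), of "{i}"] assms(3,4) m
    by (simp add: c_def gravity_center_def)
  then have qp: "q \<le> p"
    unfolding power2_norm_eq_inner
    by (simp add: inner_diff_left inner_diff_right inner_commute xi p_def q_def)
  have "sum x (vertex_indices x) = (n + 1) *\<^sub>R c"
    by (simp add: c_def gravity_center_def n_def add.commute)
  then have sumV: "sum x V = (n + 1) *\<^sub>R c - x i"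
    using assms(3) by (simp add: V_def sum_diff1)
  define P where "P = (1 + s) *\<^sub>R c - \<mu> *\<^sub>R x i"
  obtain R where R: "R \<subseteq> V" "card R = m"
    and le: "(- 2 * \<mu>) *\<^sub>R P \<bullet> sum x R + \<mu>\<^sup>2 * (norm (sum x R))\<^sup>2
         \<le> m / n * ((- 2 * \<mu>) *\<^sub>R P \<bullet> sum x V)
           + \<mu>\<^sup>2 * (m * (real m - 1) / (n * (n - 1)) * (norm (sum x V))\<^sup>2 + m * (n - m) / (n - 1))"
    using exists_subset_le_average[OF V m(3) _ m(1,2), of x "(- 2 * \<mu>) *\<^sub>R P" "\<mu>\<^sup>2"] assms(2)
    unfolding n_def V_def by blast
  define J where "J = insert i R"
  have J: "J \<subseteq> vertex_indices x" "i \<in> J" "card J = m + 1"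
    using R assms(3) V finite_subset[OF R(1)] by (auto simp: J_def V_def card_insert_if)
  have "i \<notin> R" "finite R"
    using R(1) finite_subset[OF R(1) V(1)] by (auto simp: V_def)
  then have "sum x J = x i + sum x R"
    by (simp add: J_def)
  then have "(1 + s) *\<^sub>R c - s *\<^sub>R gravity_center x J = P - \<mu> *\<^sub>R sum x R"
    by (simp add: P_def \<mu>_def gravity_center_def J(3) k_def algebra_simps)
  then have "(norm ((1 + s) *\<^sub>R c - s *\<^sub>R gravity_center x J))\<^sup>2
      = P \<bullet> P + ((- 2 * \<mu>) *\<^sub>R P \<bullet> sum x R + \<mu>\<^sup>2 * (norm (sum x R))\<^sup>2)"
    unfolding power2_norm_eq_inner
    by (simp add: inner_diff_left inner_diff_right inner_commute power2_eq_square)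
  also have "\<dots> \<le> P \<bullet> P + (m / n * ((- 2 * \<mu>) *\<^sub>R P \<bullet> sum x V)
      + \<mu>\<^sup>2 * (m * (real m - 1) / (n * (n - 1)) * (norm (sum x V))\<^sup>2 + m * (n - m) / (n - 1)))"
    using le by simp
  also have "\<dots> \<le> 1"
  proof -
    have 1: "P \<bullet> P = (1 + s)\<^sup>2 * q - 2 * (1 + s) * \<mu> * p + \<mu>\<^sup>2"
      unfolding P_def p_def q_def
      by (simp add: inner_diff_left inner_diff_right inner_commute xi power2_eq_square algebra_simps)
    have 2: "(- 2 * \<mu>) *\<^sub>R P \<bullet> sum x V = - 2 * \<mu> * ((1 + s) * ((n + 1) * q - p) - \<mu> * ((n + 1) * p - 1))"
    proof -
      have "P \<bullet> sum x V = (1 + s) * ((n + 1) * q - p) - \<mu> * ((n + 1) * p - 1)"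
        unfolding P_def p_def q_def sumV
        by (simp add: inner_diff_left inner_diff_right inner_commute xi algebra_simps)
      then show ?thesis by simp
    qed
    have 3: "(norm (sum x V))\<^sup>2 = (n + 1)\<^sup>2 * q - 2 * (n + 1) * p + 1"
      unfolding power2_norm_eq_inner sumV p_def q_def
      by (simp add: inner_diff_left inner_diff_right inner_commute xi power2_eq_square algebra_simps)
    have 4: "real m = k - 1" "k - 1 - 1 = k - 2"
      by (simp_all add: k_def)
    show ?thesis
      using average_le_1[OF k \<mu> qp, folded sk] by (simp only: 1 2 3 4 add.assoc)
  qed
  finally have le1: "(norm ((1 + s) *\<^sub>R c - s *\<^sub>R gravity_center x J))\<^sup>2 \<le> 1" .
  have card_J: "1 \<le> card J" "card J \<le> CARD('n)"
    using J(3) m assms(5) by simp_all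
  have "real (card J) = k"
    by (simp add: J(3) k_def)
  then have "suitable x J"
    using le1 suitable_iff_norm[OF assms(1) J(1) card_J] by (simp only: c_def s_def n_def)
  with J show ?thesis by blast
qed

end
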